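(* Let $n\ge 1$, $1\le a\le n$, $b=n-a$. Let $\pi=(\pi(1),\dots,\pi(a))$ be a sequence of distinct elements of $[n]$ and $\theta$ an ordering of $[n]\setminus\{\pi(1),\dots,\pi(a)\}$. Let $\mathcal{S}(\theta,\pi)$ be the set of shuffles of $\theta$ and $\pi$, and let $\mathcal{P}(b,a)$ be the set of partitions with exactly $a$ parts (parts allowed to be $0$) each at most $b$, i.e. weakly increasing sequences $0\le\lambda_1\le\cdots\le\lambda_a\le b$ (equivalently multisets of size $a$ from $\{0,\dots,b\}$). For $\sigma\in\mathcal{S}(\theta,\pi)$ and $i=1,\dots,a$ let $\sigma_i$ be the subword of $\sigma$ consisting of the letters of $\theta$ together with $\pi(i),\dots,\pi(a)$, with $\sigma_{a+1}=\theta$; let $m_i=\mathrm{maj}(\sigma_i)-\mathrm{maj}(\sigma_{i+1})$ and $t_i=m_i-d_i(\pi)$. Define $\Phi(\sigma)$ to be the multiset $\{t_1,\dots,t_a\}$. Then $\Phi$ is a bijection from $\mathcal{S}(\theta,\pi)$ onto $\mathcal{P}(b,a)$.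
   Context: For a word $w=w(1)\cdots w(m)$ of distinct integers, index $i\in\{1,\dots,m-1\}$ is a descent if $w(i)>w(i+1)$; $\mathrm{maj}(w)=\sum_{i=1}^{m-1} i\,\chi(w(i)>w(i+1))$ is the sum of the descents; $d_k(w)$ denotes the number of descents of $w$ that are $\ge k$. A shuffle of $\theta$ and $\pi$ is a word of length $n$ (a permutation of $[n]$) containing both $\theta$ and $\pi$ as subwords. *)

theory Defs
  imports "HOL-Library.Multiset" "HOL-Library.Sublist"
begin

(* Positions of words are 1-based, so w(i) is w ! (i - 1). *)

definition descents :: "'a::linorder list \<Rightarrow> nat set" where
  "descents w = {i. 1 \<le> i \<and> i < length w \<and> w ! (i - 1) > w ! i}"

definition maj :: "'a::linorder list \<Rightarrow> nat" where
  "maj w = \<Sum> (descents w)"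

definition descents_from :: "nat \<Rightarrow> 'a::linorder list \<Rightarrow> nat" where
  "descents_from k w = card {i \<in> descents w. k \<le> i}"

definition shuffle_words :: "nat \<Rightarrow> nat list \<Rightarrow> nat list \<Rightarrow> nat list set" where
  "shuffle_words n \<theta> \<pi> =
     {\<sigma>. length \<sigma> = n \<and> distinct \<sigma> \<and> set \<sigma> = {1..n} \<and> subseq \<theta> \<sigma> \<and> subseq \<pi> \<sigma>}"

definition box_partitions :: "nat \<Rightarrow> nat \<Rightarrow> int multiset set" where
  "box_partitions b a = {M. size M = a \<and> set_mset M \<subseteq> {0..int b}}"

definition sub_shuffle :: "'a list \<Rightarrow> 'a list \<Rightarrow> 'a list \<Rightarrow> nat \<Rightarrow> 'a list" where
  "sub_shuffle \<theta> \<pi> \<sigma> i =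
     (if i \<le> length \<pi> then filter (\<lambda>x. x \<in> set \<theta> \<union> set (drop (i - 1) \<pi>)) \<sigma> else \<theta>)"

definition maj_increment :: "'a::linorder list \<Rightarrow> 'a list \<Rightarrow> 'a list \<Rightarrow> nat \<Rightarrow> int" where
  "maj_increment \<theta> \<pi> \<sigma> i =
     int (maj (sub_shuffle \<theta> \<pi> \<sigma> i)) - int (maj (sub_shuffle \<theta> \<pi> \<sigma> (i + 1)))"

definition shuffle_part :: "'a::linorder list \<Rightarrow> 'a list \<Rightarrow> 'a list \<Rightarrow> nat \<Rightarrow> int" where
  "shuffle_part \<theta> \<pi> \<sigma> i = maj_increment \<theta> \<pi> \<sigma> i - int (descents_from i \<pi>)"

definition Phi :: "'a::linorder list \<Rightarrow> 'a list \<Rightarrow> 'a list \<Rightarrow> int multiset" where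
  "Phi \<theta> \<pi> \<sigma> = {# shuffle_part \<theta> \<pi> \<sigma> i. i \<in># mset_set {1..length \<pi>} #}"

lemma filter_eq_if_subseq_distinct:
  assumes "distinct \<sigma>" "subseq xs \<sigma>"
  shows "filter (\<lambda>x. x \<in> set xs) \<sigma> = xs"
proof -
  have dx: "distinct xs" and sx: "set xs \<subseteq> set \<sigma>"
    using assms by (auto simp: subseq_conv_nths distinct_nthsI dest: in_set_nthsD)
  have "subseq (filter (\<lambda>x. x \<in> set xs) xs) (filter (\<lambda>x. x \<in> set xs) \<sigma>)"
    by (rule subseq_filter[OF assms(2)])
  hence "subseq xs (filter (\<lambda>x. x \<in> set xs) \<sigma>)" by simp
  moreover have "set (filter (\<lambda>x. x \<in> set xs) \<sigma>) = set xs" using sx by auto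
  hence "length (filter (\<lambda>x. x \<in> set xs) \<sigma>) = length xs"
    using assms(1) dx by (metis distinct_card distinct_filter)
  ultimately show ?thesis using subseq_same_length by metis
qed

lemma shuffle_words_eq_shuffles:
  assumes "distinct \<pi>" "set \<pi> \<subseteq> {1..n}" "distinct \<theta>" "set \<theta> = {1..n} - set \<pi>"
  shows "shuffle_words n \<theta> \<pi> = shuffles \<theta> \<pi>"
proof (intro equalityI subsetI)
  fix \<sigma> assume s: "\<sigma> \<in> shuffle_words n \<theta> \<pi>"
  have "filter (\<lambda>x. x \<in> set \<theta>) \<sigma> = \<theta>" "filter (\<lambda>x. x \<in> set \<pi>) \<sigma> = \<pi>"
    using s by (auto simp: shuffle_words_def intro: filter_eq_if_subseq_distinct)
  moreover have "filter (\<lambda>x. x \<in> set \<pi>) \<sigma> = filter (\<lambda>x. \<not> x \<in> set \<theta>) \<sigma>"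
    using s assms by (intro filter_cong) (auto simp: shuffle_words_def)
  ultimately show "\<sigma> \<in> shuffles \<theta> \<pi>"
    using partition_in_shuffles[of \<sigma> "\<lambda>x. x \<in> set \<theta>"] by simp
next
  fix \<sigma> assume s: "\<sigma> \<in> shuffles \<theta> \<pi>"
  have disj: "set \<theta> \<inter> set \<pi> = {}" using assms by auto
  have "set \<sigma> = {1..n}" using set_shuffles[OF s] assms by auto
  moreover have d: "distinct \<sigma>" using distinct_disjoint_shuffles[OF assms(3,1) disj s] .
  ultimately have "length \<sigma> = n" by (metis distinct_card card_atLeastAtMost diff_Suc_1)
  moreover have "subseq \<theta> \<sigma>" "subseq \<pi> \<sigma>"
    using filter_shuffles_disjoint1(1)[OF disj s] filter_shuffles_disjoint2(1)[OF disj s]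
    by (metis subseq_filter_left)+
  ultimately show "\<sigma> \<in> shuffle_words n \<theta> \<pi>"
    using \<open>set \<sigma> = {1..n}\<close> d by (simp add: shuffle_words_def)
qed

end

theory Submission
  imports Defs
begin

text \<open>
  Inserting a letter \<open>x\<close> into a word \<open>w\<close> at position \<open>j\<close> raises \<open>maj\<close> by \<open>e j\<close> or by
  \<open>e j + j\<close>, where \<open>e j\<close> is the number of descents of \<open>x # drop j w\<close>; in the first case
  \<open>e (j - 1) = e j + 1\<close>, in the second \<open>e (j - 1) = e j\<close>. Hence the increments at positions
  \<open>0, \<dots>, j\<close> fill the interval \<open>[e j, e j + j]\<close> without repetition. Now insert the letters of
  \<open>\<pi>\<close> from the last to the first, each to the left of its predecessor. If a letter goes to
  position \<open>j\<close>, the (normalised) increments of all later letters lie in the interval of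
  increments at positions \<open>0, \<dots>, j\<close>. So the first increment is recovered from the multiset
  of all increments as the element belonging to the rightmost position, and one recurses.
\<close>

section \<open>Descents and \<open>maj\<close> when a letter is prepended\<close>

abbreviation des :: "'a::linorder list \<Rightarrow> nat" where
  "des w \<equiv> card (descents w)"

lemma finite_descents [simp]: "finite (descents w)"
  by (rule finite_subset[of _ "{..<length w}"]) (auto simp: descents_def)

lemma descents_Nil [simp]: "descents [] = {}"
  by (simp add: descents_def)

lemma descents_Cons:
  "descents (x # w) = (if w \<noteq> [] \<and> x > hd w then {1} else {}) \<union> Suc ` descents w"
proof (intro set_eqI)
  fix i
  show "i \<in> descents (x # w) \<longleftrightarrow>
    i \<in> (if w \<noteq> [] \<and> x > hd w then {1} else {}) \<union> Suc ` descents w"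
  proof (cases i)
    case 0
    then show ?thesis by (auto simp: descents_def)
  next
    case (Suc k)
    then show ?thesis
      by (cases k) (auto simp: descents_def hd_conv_nth image_iff)
  qed
qed

lemma des_Cons: "des (x # w) = (if w \<noteq> [] \<and> x > hd w then 1 else 0) + des w"
proof -
  have "1 \<notin> Suc ` descents w" by (auto simp: descents_def)
  then show ?thesis by (simp add: descents_Cons card_image)
qed

text \<open>Each descent of \<open>w\<close> moves one place to the right, and a descent at the new
  front adds 1.\<close>

lemma maj_Cons: "maj (x # w) = maj w + des (x # w)"
proof -
  have "1 \<notin> Suc ` descents w" by (auto simp: descents_def)
  moreover have "\<Sum> (Suc ` descents w) = maj w + des w"
    by (simp add: sum.reindex maj_def sum.distrib flip: add_Suc_right)
       (simp add: sum_Suc)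
  ultimately show ?thesis
    unfolding des_Cons by (simp add: maj_def descents_Cons)
qed

lemma descents_from_1: "descents_from (Suc 0) w = des w"
  unfolding descents_from_def by (rule arg_cong[where f = card]) (auto simp: descents_def)

lemma descents_from_Cons:
  assumes "i \<ge> 1"
  shows "descents_from (Suc i) (x # w) = descents_from i w"
proof -
  have "{k \<in> descents (x # w). Suc i \<le> k} = Suc ` {k \<in> descents w. i \<le> k}"
    using assms by (auto simp: descents_Cons)
  then show ?thesis by (simp add: descents_from_def card_image)
qed

lemma des_append_diff:
  assumes "r \<noteq> []"
  shows "int (des (p @ r @ v)) - int (des (p @ r @ v')) = int (des (r @ v)) - int (des (r @ v'))"
  using assms by (induction p) (auto simp: des_Cons hd_append)

section \<open>Gains from inserting one letter\<close>

text \<open>By \<open>maj_Cons\<close>, \<open>y\<close> and each letter of \<open>u\<close>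
  contribute the change in the number of descents, which is the same for all of them.\<close>

lemma maj_insert_diff:
  "int (maj (u @ y # x # v)) - int (maj (u @ y # v)) =
     int (des (x # v)) + int (Suc (length u)) * (int (des (y # x # v)) - int (des (y # v)))"
proof (induction u)
  case Nil
  then show ?case by (simp add: maj_Cons)
next
  case (Cons z u)
  have "int (des ((z # u) @ y # x # v)) - int (des ((z # u) @ y # v))
      = int (des (y # x # v)) - int (des (y # v))"
    using des_append_diff[of "[y]" "z # u" "x # v" v] by simp
  with Cons show ?case by (simp add: maj_Cons algebra_simps)
qed

text \<open>Each step adds one new endpoint: on the left if \<open>e\<close> drops by one, on the
  right if \<open>e\<close> stays.\<close>

lemma bij_betw_growing_interval:
  fixes f e :: "nat \<Rightarrow> int"
  assumes "f 0 = e 0"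
    and "\<And>j. j < K \<Longrightarrow> f (Suc j) = e (Suc j) \<and> e j = e (Suc j) + 1 \<or>
                        f (Suc j) = e (Suc j) + int (Suc j) \<and> e j = e (Suc j)"
    and "j \<le> K"
  shows "bij_betw f {..j} {e j..e j + int j}"
  using assms(3)
proof (induction j)
  case 0
  then show ?case using assms(1) by (simp add: bij_betw_def)
next
  case (Suc j)
  then have IH: "bij_betw f {..j} {e j..e j + int j}" by simp
  have "{e (Suc j)..e (Suc j) + int (Suc j)} = insert (f (Suc j)) {e j..e j + int j}"
    and "f (Suc j) \<notin> {e j..e j + int j}"
    using assms(2)[of j] Suc.prems by auto
  with IH show ?case by (auto simp: bij_betw_def atMost_Suc)
qed

definition insertion_gain :: "'a::linorder \<Rightarrow> 'a list \<Rightarrow> nat \<Rightarrow> int" where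
  "insertion_gain x w j = int (maj (take j w @ x # drop j w)) - int (maj w)"

lemma bij_betw_insertion_gain:
  assumes "distinct (x # w)" and "j \<le> length w"
  shows "bij_betw (insertion_gain x w) {..j}
           {int (des (x # drop j w))..int (des (x # drop j w)) + int j}"
proof (rule bij_betw_growing_interval[OF _ _ assms(2)])
  show "insertion_gain x w 0 = int (des (x # drop 0 w))"
    by (simp add: insertion_gain_def maj_Cons)
next
  fix j assume j: "j < length w"
  define y where "y = w ! j"
  define v where "v = drop (Suc j) w"
  have w: "w = take j w @ y # v" and d: "drop j w = y # v"
    using j by (simp_all add: y_def v_def id_take_nth_drop[symmetric] Cons_nth_drop_Suc)
  have t: "take (Suc j) w = take j w @ [y]"
    using j by (simp add: y_def take_Suc_conv_app_nth)
  have dist: "x \<noteq> y" "v \<noteq> [] \<Longrightarrow> x \<noteq> hd v" "v \<noteq> [] \<Longrightarrow> y \<noteq> hd v"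
    using assms(1) by (subst (asm) w; cases v; auto)+
  have g: "insertion_gain x w (Suc j) = int (des (x # v)) +
      int (Suc j) * (int (des (y # x # v)) - int (des (y # v)))"
    using maj_insert_diff[of "take j w" y x v] j
    by (simp add: insertion_gain_def t flip: v_def w)
  show "insertion_gain x w (Suc j) = int (des (x # drop (Suc j) w)) \<and>
          int (des (x # drop j w)) = int (des (x # drop (Suc j) w)) + 1 \<or>
        insertion_gain x w (Suc j) = int (des (x # drop (Suc j) w)) + int (Suc j) \<and>
          int (des (x # drop j w)) = int (des (x # drop (Suc j) w))"
    \<comment> \<open>As \<open>x\<close> and \<open>y\<close> differ, exactly one of their two
      orders is a descent, so \<open>des (x # y # v) + des (y # x # v) = des (x # v) + des (y # v) +
      1\<close>. Inserting \<open>x\<close> behind \<open>y\<close> adds at most one descent, which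
      leaves the two alternatives.\<close>
    unfolding g d v_def[symmetric] using dist by (auto simp: des_Cons not_less)
qed

section \<open>Recovering an element from a multiset\<close>

text \<open>The added element is recognisable as the one of largest index under \<open>g\<close>,
  since the rest of the multiset has indices at most \<open>j\<close>.\<close>

lemma bij_betw_add_mset_prefix_image:
  fixes g :: "nat \<Rightarrow> 'b"
  assumes inj: "inj_on g {..K}"
  shows "bij_betw (\<lambda>(j, M). add_mset (g j) M)
           (SIGMA j:{..K}. {M. size M = m \<and> set_mset M \<subseteq> g ` {..j}})
           {M. size M = Suc m \<and> set_mset M \<subseteq> g ` {..K}}"
  (is "bij_betw ?f ?A ?B")
proof -
  have le: "j' \<le> j"
    if "j \<le> K" "j' \<le> K" "set_mset M \<subseteq> g ` {..j}" "add_mset (g j) M = add_mset (g j') M'"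
    for j j' M M'
  proof -
    have "g j' \<in> g ` {..j}" using that by (metis atMost_iff image_eqI in_mono insert_iff order_refl
          set_mset_add_mset_insert)
    then obtain i where "i \<le> j" "g i = g j'" by auto
    with inj that show ?thesis by (metis atMost_iff inj_onD order_trans)
  qed
  have "inj_on ?f ?A"
  proof (rule inj_onI)
    fix p p' assume p: "p \<in> ?A" "p' \<in> ?A" and eq: "?f p = ?f p'"
    obtain j M j' M' where jM: "p = (j, M)" "p' = (j', M')" by fastforce
    with p eq have "j = j'" by (auto intro: antisym le le[OF _ _ _ sym])
    with jM eq show "p = p'" by simp
  qed
  moreover have "?f ` ?A = ?B"
  proof (intro equalityI subsetI)
    fix M assume "M \<in> ?f ` ?A"
    then show "M \<in> ?B" by fastforce
  next
    fix M assume M: "M \<in> ?B"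
    define J where "J = {j. j \<le> K \<and> g j \<in># M}"
    from M have "M \<noteq> {#}" by auto
    with M have "J \<noteq> {}" by (fastforce simp: J_def)
    moreover have fin: "finite J" by (auto simp: J_def)
    ultimately have "Max J \<in> J" by simp
    then have j: "Max J \<le> K" "g (Max J) \<in># M" by (auto simp: J_def)
    have "set_mset M \<subseteq> g ` {..Max J}"
    proof
      fix z assume z: "z \<in># M"
      then obtain i where "i \<le> K" "z = g i" using M by auto
      with z fin show "z \<in> g ` {..Max J}" by (auto simp: J_def)
    qed
    then have "(Max J, M - {#g (Max J)#}) \<in> ?A"
      using j M by (auto simp: size_Diff_singleton dest: in_diffD)
    moreover have "?f (Max J, M - {#g (Max J)#}) = M" using j by simp
    ultimately show "M \<in> ?f ` ?A" by (rule image_eqI[OF sym, rotated])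
  qed
  ultimately show ?thesis by (simp add: bij_betw_def)
qed

section \<open>Cutting a shuffle at the last letter of the second word\<close>

lemma append_Cons_in_shuffles:
  "s \<in> shuffles u r \<Longrightarrow> s @ x # u' \<in> shuffles (u @ u') (r @ [x])"
proof (induction s arbitrary: u r)
  case Nil
  then show ?case by (simp add: Cons_in_shuffles_iff)
next
  case (Cons z s)
  then show ?case
    by (auto simp: Cons_in_shuffles_iff)
qed

text \<open>Behind the last letter \<open>x\<close> of the second word only letters of
  \<open>u\<close> can follow; \<open>j\<close> counts those in front of it.\<close>

lemma shuffles_snoc_decomp:
  "s \<in> shuffles u (r @ [x]) \<Longrightarrow>
     \<exists>j\<le>length u. \<exists>s' \<in> shuffles (take j u) r. s = s' @ x # drop j u"
proof (induction s arbitrary: u r)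
  case Nil
  then show ?case by simp
next
  case (Cons z s)
  from Cons.prems consider
      (left) u' where "u = z # u'" "s \<in> shuffles u' (r @ [x])"
    | (last) "r = []" "z = x" "s = u"
    | (right) r' where "r = z # r'" "s \<in> shuffles u (r' @ [x])"
    by (cases u; cases r) (auto simp: Cons_in_shuffles_iff)
  then show ?case
  proof cases
    case left
    from Cons.IH[OF left(2)] obtain j s' where
      "j \<le> length u'" "s' \<in> shuffles (take j u') r" "s = s' @ x # drop j u'" by blast
    with left show ?thesis
      by (intro exI[of _ "Suc j"] conjI bexI[of _ "z # s'"]) (auto simp: Cons_in_shuffles_iff)
  next
    case last
    then show ?thesis by (intro exI[of _ 0]) auto
  next
    case right
    from Cons.IH[OF right(2)] obtain j s' where
      "j \<le> length u" "s' \<in> shuffles (take j u) r'" "s = s' @ x # drop j u" by blast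
    with right show ?thesis
      by (intro exI[of _ j] conjI bexI[of _ "z # s'"]) (auto simp: Cons_in_shuffles_iff)
  qed
qed

lemma shuffles_snoc:
  "shuffles u (r @ [x]) =
     (\<lambda>(j, s). s @ x # drop j u) ` (SIGMA j:{..length u}. shuffles (take j u) r)"
proof (intro equalityI subsetI)
  fix s assume "s \<in> shuffles u (r @ [x])"
  from shuffles_snoc_decomp[OF this]
  show "s \<in> (\<lambda>(j, s). s @ x # drop j u) ` (SIGMA j:{..length u}. shuffles (take j u) r)"
    by force
next
  fix s assume "s \<in> (\<lambda>(j, s). s @ x # drop j u) ` (SIGMA j:{..length u}. shuffles (take j u) r)"
  then show "s \<in> shuffles u (r @ [x])"
    by auto (metis append_take_drop_id append_Cons_in_shuffles)
qed

section \<open>The bijection for a fixed completed suffix\<close>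

text \<open>
  In \<open>suffix_parts v r s\<close> the word \<open>v\<close> is the part of the shuffle that is already complete and
  \<open>r\<close> holds the letters still to be inserted to its left. Normalising by descents of the word
  \<open>r @ v\<close>, rather than of the letters of \<open>\<pi>\<close> in it, makes the values range over
  \<open>0, \<dots>, length u\<close> for every \<open>v\<close>.
\<close>

fun suffix_parts :: "'a::linorder list \<Rightarrow> 'a list \<Rightarrow> 'a list \<Rightarrow> int multiset" where
  "suffix_parts v [] s = {#}"
| "suffix_parts v (y # r) s =
     add_mset (int (maj (s @ v)) - int (maj (filter (\<lambda>z. z \<noteq> y) s @ v)) - int (des (y # r @ v)))
       (suffix_parts v r (filter (\<lambda>z. z \<noteq> y) s))"

lemma filter_neq_shuffles:
  assumes "s \<in> shuffles u (y # r)" and "distinct (y # r @ u)"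
  shows "filter (\<lambda>z. z \<noteq> y) s \<in> shuffles u r"
proof -
  have "filter (\<lambda>z. z \<noteq> y) s \<in> filter (\<lambda>z. z \<noteq> y) ` shuffles u (y # r)"
    using assms(1) by blast
  also have "\<dots> = shuffles (filter (\<lambda>z. z \<noteq> y) u) (filter (\<lambda>z. z \<noteq> y) (y # r))"
    by (rule filter_shuffles)
  also have "filter (\<lambda>z. z \<noteq> y) u = u"
    using assms(2) by (auto simp: filter_id_conv)
  also have "filter (\<lambda>z. z \<noteq> y) (y # r) = r"
    using assms(2) by (auto simp: filter_id_conv)
  finally show ?thesis .
qed

text \<open>Once \<open>r\<close> is used up, only the insertion of \<open>x\<close> into
  \<open>u @ u' @ v\<close> remains, which gives the added element. The other parts change only in
  their normalisation, by an amount that \<open>des_append_diff\<close> shows to be independent of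
  the letters in front of \<open>x\<close>.\<close>

lemma suffix_parts_snoc:
  assumes "s \<in> shuffles u r" and "distinct (u @ u' @ x # r)"
  shows "suffix_parts v (r @ [x]) (s @ x # u') =
    add_mset (int (maj (u @ x # u' @ v)) - int (maj (u @ u' @ v)) - int (des (x # v)))
      (image_mset (\<lambda>t. t + (int (des (x # u' @ v)) - int (des (x # v))))
        (suffix_parts (x # u' @ v) r s))"
  using assms
proof (induction r arbitrary: s)
  case Nil
  then have "filter (\<lambda>z. z \<noteq> x) u = u" "filter (\<lambda>z. z \<noteq> x) u' = u'"
    by (auto simp: filter_id_conv)
  with Nil show ?case by simp
next
  case (Cons y r)
  have s: "filter (\<lambda>z. z \<noteq> y) s \<in> shuffles u r"
    using Cons.prems by (intro filter_neq_shuffles) auto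
  have "filter (\<lambda>z. z \<noteq> y) u' = u'" "x \<noteq> y"
    using Cons.prems by (auto simp: filter_id_conv)
  moreover have "int (des (y # r @ x # u' @ v)) - int (des (y # r @ x # v))
      = int (des (x # u' @ v)) - int (des (x # v))"
    using des_append_diff[of "[x]" "y # r" "u' @ v" v] by simp
  ultimately show ?case
    using Cons.IH[OF s] Cons.prems by (simp add: add_mset_commute algebra_simps)
qed

lemma bij_betw_Sigma_fibres:
  assumes "\<And>i. i \<in> I \<Longrightarrow> bij_betw (f i) (A i) (B i)"
  shows "bij_betw (\<lambda>(i, x). (i, f i x)) (SIGMA i:I. A i) (SIGMA i:I. B i)"
proof (rule bij_betw_imageI)
  show "inj_on (\<lambda>(i, x). (i, f i x)) (SIGMA i:I. A i)"
    using assms by (auto simp: inj_on_def bij_betw_def)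
  have "f i ` A i = B i" if "i \<in> I" for i
    using assms[OF that] by (simp add: bij_betw_def)
  then show "(\<lambda>(i, x). (i, f i x)) ` (SIGMA i:I. A i) = (SIGMA i:I. B i)"
    by (auto simp: image_iff) blast
qed

lemma bij_betw_image_mset_shift:
  fixes c :: int
  shows "bij_betw (image_mset (\<lambda>t. t + c)) (box_partitions k m)
           {M. size M = m \<and> set_mset M \<subseteq> {c..c + int k}}"
  by (rule bij_betw_byWitness[where f' = "image_mset (\<lambda>t. t - c)"])
     (auto simp: box_partitions_def multiset.map_comp comp_def subset_iff diff_le_eq add.commute)

text \<open>The letter \<open>x\<close> inserted first is the last of the word, hence reverse
  induction. Placing it at \<open>j\<close> leaves \<open>take j u\<close> to be shuffled with
  \<open>r\<close>, while \<open>x # drop j u\<close> joins \<open>v\<close>; so both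
  \<open>u\<close> and \<open>v\<close> must vary.\<close>

lemma bij_betw_suffix_parts:
  assumes "distinct (u @ v @ r)"
  shows "bij_betw (suffix_parts v r) (shuffles u r) (box_partitions (length u) (length r))"
  using assms
proof (induction r arbitrary: u v rule: rev_induct)
  case Nil
  then show ?case by (auto simp: bij_betw_def box_partitions_def)
next
  case (snoc x r)
  define K where "K = length u"
  define g where "g j = insertion_gain x (u @ v) j - int (des (x # v))" for j
  \<comment> \<open>\<open>e j\<close> plays two roles: lower end of the gains at positions up to
    \<open>j\<close>, and shift in \<open>suffix_parts_snoc\<close>. Hence the fibre over
    \<open>j\<close> fills exactly \<open>A j\<close>.\<close>
  define e where "e j = int (des (x # drop j u @ v)) - int (des (x # v))" for j
  define A where "A j = {M. size M = length r \<and> set_mset M \<subseteq> g ` {..j}}" for j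
  have g: "bij_betw g {..j} {e j..e j + int j}" if "j \<le> K" for j
  proof -
    have "bij_betw (insertion_gain x (u @ v)) {..j}
        {int (des (x # drop j u @ v))..int (des (x # drop j u @ v)) + int j}"
      using bij_betw_insertion_gain[of x "u @ v" j] snoc.prems that by (auto simp: K_def)
    moreover have "bij_betw (\<lambda>t. t - int (des (x # v)))
        {int (des (x # drop j u @ v))..int (des (x # drop j u @ v)) + int j} {e j..e j + int j}"
      by (rule bij_betw_byWitness[where f' = "\<lambda>t. t + int (des (x # v))"]) (auto simp: e_def)
    ultimately have "bij_betw ((\<lambda>t. t - int (des (x # v))) \<circ> insertion_gain x (u @ v))
        {..j} {e j..e j + int j}"
      by (rule bij_betw_trans)
    then show ?thesis by (simp add: comp_def g_def[abs_def])
  qed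
  define h where "h = (\<lambda>(j, s). s @ x # drop j u)"
  define Sig where "Sig = (SIGMA j:{..K}. shuffles (take j u) r)"
  define G where "G j = image_mset (\<lambda>t. t + e j) \<circ> suffix_parts (x # drop j u @ v) r" for j
  have G: "bij_betw (G j) (shuffles (take j u) r) (A j)" if "j \<le> K" for j
  proof -
    have "distinct ((take j u @ drop j u) @ v @ r @ [x])" using snoc.prems by simp
    then have "distinct (take j u @ (x # drop j u @ v) @ r)"
      by (auto simp del: append_take_drop_id)
    from snoc.IH[OF this] that
    have "bij_betw (suffix_parts (x # drop j u @ v) r) (shuffles (take j u) r)
        (box_partitions j (length r))"
      by (simp add: K_def min_absorb2)
    moreover have "bij_betw (image_mset (\<lambda>t. t + e j)) (box_partitions j (length r)) (A j)"
      using bij_betw_image_mset_shift[of "e j" j "length r"] g[OF that]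
      by (simp add: A_def bij_betw_def)
    ultimately show ?thesis unfolding G_def by (rule bij_betw_trans)
  qed
  have "bij_betw (\<lambda>(j, s). (j, G j s)) Sig (SIGMA j:{..K}. A j)"
    unfolding Sig_def using G by (intro bij_betw_Sigma_fibres) simp
  moreover have "bij_betw (\<lambda>(j, M). add_mset (g j) M) (SIGMA j:{..K}. A j)
      {M. size M = Suc (length r) \<and> set_mset M \<subseteq> g ` {..K}}"
    unfolding A_def using g[of K] by (intro bij_betw_add_mset_prefix_image) (simp add: bij_betw_def)
  \<comment> \<open>At \<open>j = K\<close> nothing of \<open>u\<close> is left behind
    \<open>x\<close>, so \<open>e K = 0\<close> and the gains fill \<open>{0..K}\<close>.\<close>
  moreover have "{M. size M = Suc (length r) \<and> set_mset M \<subseteq> g ` {..K}}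
      = box_partitions K (length (r @ [x]))"
    using g[of K] by (simp add: bij_betw_def box_partitions_def e_def K_def)
  ultimately have "bij_betw ((\<lambda>(j, M). add_mset (g j) M) \<circ> (\<lambda>(j, s). (j, G j s))) Sig
      (box_partitions K (length (r @ [x])))"
    using bij_betw_trans[of _ Sig] by simp
  moreover have "((\<lambda>(j, M). add_mset (g j) M) \<circ> (\<lambda>(j, s). (j, G j s))) p
      = (suffix_parts v (r @ [x]) \<circ> h) p" if "p \<in> Sig" for p
  proof -
    obtain j s where p: "p = (j, s)" by fastforce
    with that have j: "j \<le> K" and s: "s \<in> shuffles (take j u) r" by (auto simp: Sig_def)
    have "distinct ((take j u @ drop j u) @ x # r)" using snoc.prems by auto
    then have "distinct (take j u @ drop j u @ x # r)" by (simp only: append_assoc)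
    moreover have eq: "take j u @ drop j u @ v = u @ v" by (simp flip: append_assoc)
    ultimately show ?thesis
      using suffix_parts_snoc[OF s, of "drop j u" x v] j
      by (simp add: p h_def G_def g_def e_def insertion_gain_def K_def eq)
  qed
  ultimately have "bij_betw (suffix_parts v (r @ [x]) \<circ> h) Sig
      (box_partitions K (length (r @ [x])))"
    by (rule iffD1[OF bij_betw_cong, rotated])
  \<comment> \<open>Injectivity of the composite passes to \<open>suffix_parts\<close> on the image
    of \<open>Sig\<close> under \<open>h\<close>.\<close>
  then have "bij_betw (suffix_parts v (r @ [x])) (h ` Sig) (box_partitions K (length (r @ [x])))"
    unfolding bij_betw_def by (metis image_comp inj_on_imageI)
  then show ?case by (simp add: h_def Sig_def K_def shuffles_snoc)
qed

section \<open>Identification with \<open>Phi\<close>\<close>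

lemma Phi_Cons:
  assumes "s \<in> shuffles \<theta> (y # r)" and "distinct (\<theta> @ y # r)"
  shows "Phi \<theta> (y # r) s =
    add_mset (int (maj s) - int (maj (filter (\<lambda>z. z \<noteq> y) s)) - int (des (y # r)))
      (Phi \<theta> r (filter (\<lambda>z. z \<noteq> y) s))"
proof -
  define s' where "s' = filter (\<lambda>z. z \<noteq> y) s"
  have s': "s' \<in> shuffles \<theta> r"
    unfolding s'_def using assms by (intro filter_neq_shuffles) auto
  have set_s: "set s = insert y (set \<theta> \<union> set r)"
    using set_shuffles[OF assms(1)] by auto
  have first: "sub_shuffle \<theta> (y # r) s (Suc 0) = s"
    using set_s by (auto simp: sub_shuffle_def filter_id_conv)
  have shift: "sub_shuffle \<theta> (y # r) s (Suc i) = sub_shuffle \<theta> r s' i" if "i \<ge> 1" for i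
  proof -
    have "y \<notin> set \<theta> \<union> set (drop (i - 1) r)"
      using assms(2) by (auto dest: in_set_dropD)
    then show ?thesis
      using that by (cases i) (auto simp: sub_shuffle_def s'_def intro!: filter_cong)
  qed
  \<comment> \<open>For empty \<open>r\<close> the index 1 exceeds the length, so
    \<open>sub_shuffle\<close> takes its default value \<open>\<theta>\<close>, which is then also
    \<open>s'\<close>.\<close>
  have second: "sub_shuffle \<theta> r s' 1 = s'"
  proof (cases r)
    case Nil
    then show ?thesis using s' by (simp add: sub_shuffle_def)
  next
    case Cons
    then show ?thesis using set_shuffles[OF s'] by (auto simp: sub_shuffle_def filter_id_conv)
  qed
  have "shuffle_part \<theta> (y # r) s (Suc i) = shuffle_part \<theta> r s' i" if "i \<ge> 1" for i
    using that by (simp add: shuffle_part_def maj_increment_def shift descents_from_Cons)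
  then have "image_mset (shuffle_part \<theta> (y # r) s \<circ> Suc) (mset_set {1..length r}) = Phi \<theta> r s'"
    unfolding Phi_def by (intro image_mset_cong) simp
  moreover have "{1..length (y # r)} = insert 1 (Suc ` {1..length r})"
    by auto
  then have "mset_set {1..length (y # r)} = add_mset 1 (image_mset Suc (mset_set {1..length r}))"
    by (simp add: image_mset_mset_set)
  moreover have "shuffle_part \<theta> (y # r) s 1 = int (maj s) - int (maj s') - int (des (y # r))"
    using shift[of 1] second
    by (simp add: shuffle_part_def maj_increment_def first descents_from_1)
  ultimately show ?thesis
    unfolding Phi_def s'_def by (simp add: multiset.map_comp)
qed

text \<open>With nothing completed yet, the normalising term at a letter counts the descents of the
  suffix of \<open>\<pi>\<close> starting there, and these are the descents of \<open>\<pi>\<close>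
  from that position on.\<close>

lemma Phi_eq_suffix_parts:
  "s \<in> shuffles \<theta> \<pi> \<Longrightarrow> distinct (\<theta> @ \<pi>) \<Longrightarrow> Phi \<theta> \<pi> s = suffix_parts [] \<pi> s"
proof (induction \<pi> arbitrary: s)
  case Nil
  then show ?case by (simp add: Phi_def)
next
  case (Cons y r)
  have "filter (\<lambda>z. z \<noteq> y) s \<in> shuffles \<theta> r"
    using Cons.prems by (intro filter_neq_shuffles) auto
  with Cons show ?case by (simp add: Phi_Cons)
qed

theorem theorem4p1:
  fixes n a b :: nat and \<pi> \<theta> :: "nat list"
  assumes "n \<ge> 1" and "1 \<le> a" and "a \<le> n" and "b = n - a"
    and "length \<pi> = a" and "distinct \<pi>" and "set \<pi> \<subseteq> {1..n}"
    and "distinct \<theta>" and "set \<theta> = {1..n} - set \<pi>"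
  shows "bij_betw (Phi \<theta> \<pi>) (shuffle_words n \<theta> \<pi>) (box_partitions b a)"
proof -
  have dist: "distinct (\<theta> @ [] @ \<pi>)" using assms by auto
  have "length \<theta> = card ({1..n} - set \<pi>)"
    using assms(8,9) by (metis distinct_card)
  then have "length \<theta> = b"
    using assms by (simp add: card_Diff_subset distinct_card)
  then have "bij_betw (suffix_parts [] \<pi>) (shuffles \<theta> \<pi>) (box_partitions b a)"
    using bij_betw_suffix_parts[OF dist] assms(5) by simp
  then have "bij_betw (Phi \<theta> \<pi>) (shuffles \<theta> \<pi>) (box_partitions b a)"
    using dist by (simp add: Phi_eq_suffix_parts cong: bij_betw_cong)
  then show ?thesis
    using shuffle_words_eq_shuffles[OF assms(6-9)] by simp
qed

end
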